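(* For every integer $n\ge1$, $$OD_n\sim HOD_{n-1}\ \dot{\cup}\ HOD_{n-1}\ \dot{\cup}\ P_1\ \dot{\cup}\ Q_n\ \dot{\cup}\ Q'_n.$$
   Context: The adjacency matrix of a weighted graph has rows and columns indexed by the vertices, its $(u,v)$-entry being the weight of the edge between $u$ and $v$ if there is one, and $0$ otherwise (a loop of weight $c$ at $u$ contributes the diagonal entry $c$); unweighted graphs have all weights $1$. Two graphs are called similar, written $G_1\sim G_2$, if their adjacency matrices are similar matrices. $\dot\cup$ denotes disjoint union. The odd Aztec diamond $OD_n$ is the graph whose vertices are the black unit squares of a $(2n+1)\times(2n+1)$ chessboard with black corners, two vertices being adjacent if the corresponding squares share a corner. The halved odd Aztec diamond $HOD_n$ is the subgraph of $OD_n$ induced by the black unit squares on or above a diagonal of the $(2n+1)\times(2n+1)$ chessboard ($HOD_0$ is a single vertex). $P_n$ is the path on $n$ vertices (edge weights $1$); in particular $P_1$ is a single vertex with no edges. $Q_n$ is obtained from $P_n$ by including a loop of weight $2$ at each vertex; $Q'_n$ is obtained from $P_n$ by including a loop of weight $-2$ at each vertex. *)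

theory Defs
  imports Complex_Main "Jordan_Normal_Form.Determinant"
begin

text \<open>Finite weighted undirected graphs with loops. An edge is the set of its endpoints,
  so the edge between \<open>u\<close> and \<open>v\<close> is \<open>{u, v}\<close> and a loop at \<open>u\<close> is \<open>{u}\<close>.\<close>

record 'v wgraph =
  verts :: "'v set"
  edges :: "'v set set"
  weight :: "'v set \<Rightarrow> real"

definition adj_entry :: "'v wgraph \<Rightarrow> 'v \<Rightarrow> 'v \<Rightarrow> real" where
  "adj_entry G u v = (if {u, v} \<in> edges G then weight G {u, v} else 0)"

text \<open>Matrices of the library are indexed by natural numbers, so the adjacency matrix is taken
  with respect to a listing of the vertices.\<close>

definition enumerates :: "'v list \<Rightarrow> 'v wgraph \<Rightarrow> bool" where
  "enumerates vs G \<longleftrightarrow> distinct vs \<and> set vs = verts G"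

definition adj_mat :: "'v wgraph \<Rightarrow> 'v list \<Rightarrow> real mat" where
  "adj_mat G vs = mat (length vs) (length vs) (\<lambda>(i, j). adj_entry G (vs ! i) (vs ! j))"

text \<open>The choice of the listings is immaterial, see \<open>graph_similar_iff\<close> below.\<close>

definition graph_similar :: "'v wgraph \<Rightarrow> 'w wgraph \<Rightarrow> bool" (infix "\<sim>\<^sub>G" 50) where
  "G \<sim>\<^sub>G H \<longleftrightarrow>
     (\<exists>vs ws. enumerates vs G \<and> enumerates ws H \<and> similar_mat (adj_mat G vs) (adj_mat H ws))"

lemma similar_mat_adj_mat:
  assumes "enumerates vs G" "enumerates ws G"
  shows "similar_mat (adj_mat G vs) (adj_mat G ws)"
proof -
  define n where "n = length vs"
  have dv: "distinct vs" and dw: "distinct ws" and st: "set vs = set ws"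
    using assms by (auto simp: enumerates_def)
  have ln: "length ws = n"
    using dv dw st by (metis distinct_card n_def)
  have "\<forall>i\<in>{..<n}. \<exists>k. k < n \<and> ws ! k = vs ! i"
    using st ln by (metis in_set_conv_nth lessThan_iff n_def nth_mem)
  then obtain f where f: "\<And>i. i < n \<Longrightarrow> f i < n" "\<And>i. i < n \<Longrightarrow> ws ! f i = vs ! i"
    by (metis lessThan_iff)
  have inj: "f i = f j \<longleftrightarrow> i = j" if "i < n" "j < n" for i j
    using that f dv by (metis n_def nth_eq_iff_index_eq)
  define P :: "real mat" where "P = mat n n (\<lambda>(i, k). if k = f i then 1 else 0)"
  have Pc: "P \<in> carrier_mat n n" by (simp add: P_def)
  have PT: "P * transpose_mat P = 1\<^sub>m n"
    by (rule eq_matI)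
      (auto simp: P_def scalar_prod_def f inj if_distrib[of "\<lambda>x. x * _"] cong: if_cong)
  have TP: "transpose_mat P * P = 1\<^sub>m n"
    by (rule mat_mult_left_right_inverse[OF Pc _ PT]) (use Pc in auto)
  have PB: "P * adj_mat G ws = mat n n (\<lambda>(i, k). adj_entry G (vs ! i) (ws ! k))"
    by (rule eq_matI)
      (auto simp: P_def adj_mat_def ln scalar_prod_def f if_distrib[of "\<lambda>x. x * _"] cong: if_cong)
  have "adj_mat G vs = P * adj_mat G ws * transpose_mat P"
    unfolding PB
    by (rule eq_matI)
      (auto simp: P_def adj_mat_def n_def[symmetric] scalar_prod_def f
        if_distrib[of "\<lambda>x. _ * x"] cong: if_cong)
  then have "similar_mat_wit (adj_mat G vs) (adj_mat G ws) P (transpose_mat P)"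
    using Pc PT TP by (intro similar_mat_witI[of _ _ n]) (auto simp: adj_mat_def ln n_def)
  then show ?thesis by (auto simp: similar_mat_def)
qed

lemma graph_similar_iff:
  assumes "enumerates vs G" "enumerates ws H"
  shows "G \<sim>\<^sub>G H \<longleftrightarrow> similar_mat (adj_mat G vs) (adj_mat H ws)"
  using assms similar_mat_adj_mat similar_mat_trans unfolding graph_similar_def by metis

definition disjoint_union :: "'v wgraph \<Rightarrow> 'w wgraph \<Rightarrow> ('v + 'w) wgraph" (infixr "\<union>\<^sub>G" 65) where
  "G \<union>\<^sub>G H =
     \<lparr>verts = verts G <+> verts H,
      edges = (`) Inl ` edges G \<union> (`) Inr ` edges H,
      weight = (\<lambda>e. if e \<subseteq> range Inl then weight G (Inl -` e) else weight H (Inr -` e))\<rparr>"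

definition induced :: "'v wgraph \<Rightarrow> 'v set \<Rightarrow> 'v wgraph" where
  "induced G S = \<lparr>verts = verts G \<inter> S, edges = {e \<in> edges G. e \<subseteq> S}, weight = weight G\<rparr>"

text \<open>The pair \<open>(x, y)\<close> stands for the unit square \<open>[x, x + 1] \<times> [y, y + 1]\<close>.\<close>

definition corners :: "nat \<times> nat \<Rightarrow> (nat \<times> nat) set" where
  "corners s = {fst s, fst s + 1} \<times> {snd s, snd s + 1}"

definition black_squares :: "nat \<Rightarrow> (nat \<times> nat) set" where
  "black_squares n = {(x, y). x < 2 * n + 1 \<and> y < 2 * n + 1 \<and> even (x + y)}"

definition OD :: "nat \<Rightarrow> (nat \<times> nat) wgraph" where
  "OD n =
     \<lparr>verts = black_squares n,
      edges = {{s, t} | s t. s \<in> black_squares n \<and> t \<in> black_squares n \<and> s \<noteq> t \<and>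
                             corners s \<inter> corners t \<noteq> {}},
      weight = (\<lambda>_. 1)\<rparr>"

text \<open>Of the two diagonals, which are interchanged by a symmetry of the board, we use \<open>x = y\<close>.\<close>

definition HOD :: "nat \<Rightarrow> (nat \<times> nat) wgraph" where
  "HOD n = induced (OD n) {(x, y). x \<le> y}"

definition path_graph :: "nat \<Rightarrow> nat wgraph" where
  "path_graph n = \<lparr>verts = {1..n}, edges = {{i, i + 1} | i. 1 \<le> i \<and> i < n}, weight = (\<lambda>_. 1)\<rparr>"

definition add_loops :: "real \<Rightarrow> 'v wgraph \<Rightarrow> 'v wgraph" where
  "add_loops c G =
     \<lparr>verts = verts G,
      edges = edges G \<union> {{v} | v. v \<in> verts G},
      weight = (\<lambda>e. if is_singleton e then c else weight G e)\<rparr>"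

definition Q_graph :: "nat \<Rightarrow> nat wgraph" where
  "Q_graph n = add_loops 2 (path_graph n)"

definition Q'_graph :: "nat \<Rightarrow> nat wgraph" where
  "Q'_graph n = add_loops (-2) (path_graph n)"

end

theory Submission
  imports Defs
begin

text \<open>Write a function on the black squares as an \<open>N \<times> N\<close> matrix \<open>X\<close>, \<open>N = 2 n + 1\<close>, and let \<open>P\<close> be the
  adjacency matrix of the path on \<open>N\<close> vertices; then the adjacency operator of \<open>OD n\<close> is
  \<open>X \<mapsto> P X P\<close>. The antisymmetric matrices are spanned by the functions \<open>e (a, b + 2) - e (b + 2, a)\<close>
  with \<open>(a, b)\<close> in \<open>HOD (n - 1)\<close>, on which the operator acts as the adjacency matrix of \<open>HOD (n - 1)\<close>.
  The commutator \<open>X \<mapsto> P\<^sup>2 X - X P\<^sup>2\<close> commutes with the operator and embeds the antisymmetric matrices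
  into the symmetric ones, which gives the second copy of \<open>HOD (n - 1)\<close>. The image is orthogonal to the
  matrices commuting with \<open>P\<^sup>2\<close>, among which we find the remaining components: with the Chebyshev
  polynomials \<open>U k\<close> of \<open>P\<close>, where \<open>P U k = U (k - 1) + U (k + 1)\<close>, the matrices \<open>F j = P U (2 j)\<close> satisfy
  \<open>P F j P = F (j - 1) + 2 F j + F (j + 1)\<close> and give \<open>Q n\<close>; multiplying the rows of \<open>F j\<close> by alternating
  signs gives \<open>Q' n\<close>; the matrix \<open>K\<close> is built from the null vector of \<open>P\<close> and gives the isolated
  vertex.\<close>

section \<open>Similarity from an injective intertwiner\<close>

text \<open>The vectors \<open>T w\<close> are the columns of a matrix \<open>M\<close> with
  \<open>A * M = M * B\<close>. Equal vertex counts make \<open>M\<close> square, and injectivity of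
  the linear extension of \<open>T\<close> makes it invertible.\<close>

lemma graph_similarI:
  fixes G :: "'v wgraph" and H :: "'w wgraph" and T :: "'w \<Rightarrow> 'v \<Rightarrow> real"
  assumes fin: "finite (verts G)" "finite (verts H)"
    and card: "card (verts G) = card (verts H)"
    and tw: "\<And>v w. v \<in> verts G \<Longrightarrow> w \<in> verts H \<Longrightarrow>
      (\<Sum>v'\<in>verts G. adj_entry G v v' * T w v') = (\<Sum>w'\<in>verts H. adj_entry H w' w * T w' v)"
    and inj: "\<And>c w. (\<And>v. v \<in> verts G \<Longrightarrow> (\<Sum>w\<in>verts H. c w * T w v) = 0) \<Longrightarrow> w \<in> verts H \<Longrightarrow> c w = 0"
  shows "G \<sim>\<^sub>G H"
proof -
  obtain vs where vs: "set vs = verts G" "distinct vs"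
    using finite_distinct_list[OF fin(1)] by auto
  obtain ws where ws: "set ws = verts H" "distinct ws"
    using finite_distinct_list[OF fin(2)] by auto
  define m where "m = length vs"
  have lv: "length vs = m" by (simp add: m_def)
  have lw: "length ws = m"
    using vs ws card by (metis distinct_card m_def)
  have sumv: "(\<Sum>i<m. g (vs ! i)) = sum g (verts G)" for g :: "'v \<Rightarrow> real"
    using sum.reindex_bij_betw[OF bij_betw_nth[OF vs(2) refl refl], of g] vs(1) lv by simp
  have sumw: "(\<Sum>i<m. g (ws ! i)) = sum g (verts H)" for g :: "'w \<Rightarrow> real"
    using sum.reindex_bij_betw[OF bij_betw_nth[OF ws(2) refl refl], of g] ws(1) lw by simp
  have inv: "vs ! i \<in> verts G" "ws ! i \<in> verts H" if "i < m" for i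
    using that vs(1) ws(1) lv lw nth_mem by metis+
  define M where "M = mat m m (\<lambda>(i, j). T (ws ! j) (vs ! i))"
  define A where "A = adj_mat G vs"
  define B where "B = adj_mat H ws"
  have Mc: "M \<in> carrier_mat m m" by (simp add: M_def)
  have Ac: "A \<in> carrier_mat m m" by (simp add: A_def adj_mat_def lv)
  have Bc: "B \<in> carrier_mat m m" by (simp add: B_def adj_mat_def lw)
  have AM: "A * M = M * B"
  proof (rule eq_matI)
    fix i j assume "i < dim_row (M * B)" "j < dim_col (M * B)"
    then have ij: "i < m" "j < m" using Mc Bc by auto
    have "(A * M) $$ (i, j) = (\<Sum>k<m. adj_entry G (vs ! i) (vs ! k) * T (ws ! j) (vs ! k))"
      using ij by (simp add: A_def M_def adj_mat_def lv scalar_prod_def atLeast0LessThan)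
    also have "\<dots> = (\<Sum>w'\<in>verts H. adj_entry H w' (ws ! j) * T w' (vs ! i))"
      using sumv[of "\<lambda>v. adj_entry G (vs ! i) v * T (ws ! j) v"] tw inv ij by simp
    also have "\<dots> = (\<Sum>k<m. adj_entry H (ws ! k) (ws ! j) * T (ws ! k) (vs ! i))"
      using sumw[of "\<lambda>w'. adj_entry H w' (ws ! j) * T w' (vs ! i)"] by simp
    also have "\<dots> = (M * B) $$ (i, j)"
      using ij by (simp add: B_def M_def adj_mat_def lw scalar_prod_def atLeast0LessThan mult.commute)
    finally show "(A * M) $$ (i, j) = (M * B) $$ (i, j)" .
  qed (use Ac Bc Mc in auto)
  have "det M \<noteq> 0"
  proof
    assume "det M = 0"
    then obtain v where v: "v \<in> carrier_vec m" "v \<noteq> 0\<^sub>v m" "M *\<^sub>v v = 0\<^sub>v m"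
      using det_0_iff_vec_prod_zero_field[OF Mc] by auto
    \<comment> \<open>The kernel vector, read as a function on the vertices of \<open>H\<close>; as
      \<open>ws\<close> is distinct, each sum has at most one term.\<close>
    define c where "c = (\<lambda>w. \<Sum>i<m. if ws ! i = w then v $ i else 0)"
    have cw: "c (ws ! j) = v $ j" if "j < m" for j
    proof -
      have "c (ws ! j) = (\<Sum>i<m. if i = j then v $ i else 0)"
        unfolding c_def using that ws(2) lw by (intro sum.cong) (auto simp: nth_eq_iff_index_eq)
      then show ?thesis using that by simp
    qed
    have "(\<Sum>w\<in>verts H. c w * T w x) = 0" if x: "x \<in> verts G" for x
    proof -
      obtain i where i: "i < m" "x = vs ! i"
        using x vs(1) lv by (metis in_set_conv_nth)
      have "0 = (M *\<^sub>v v) $ i" using v(3) i by simp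
      also have "\<dots> = (\<Sum>k<m. T (ws ! k) x * v $ k)"
        using i v(1) by (simp add: M_def scalar_prod_def atLeast0LessThan)
      also have "\<dots> = (\<Sum>k<m. c (ws ! k) * T (ws ! k) x)"
        by (intro sum.cong) (auto simp: cw)
      finally show ?thesis using sumw[of "\<lambda>w. c w * T w x"] by simp
    qed
    then have "v $ j = 0" if "j < m" for j
      using inj[of c "ws ! j"] inv(2)[OF that] cw[OF that] by simp
    then have "v = 0\<^sub>v m" using v(1) by (intro eq_vecI) auto
    then show False using v(2) by simp
  qed
  then obtain M' where M': "M' \<in> carrier_mat m m" "M * M' = 1\<^sub>m m" "M' * M = 1\<^sub>m m"
    using det_non_zero_imp_unit[OF Mc, of "TYPE(real)"] unfolding Units_def by (auto simp: ring_mat_simps)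
  have "A = A * (M * M')" using Ac M' by simp
  also have "\<dots> = A * M * M'" using Ac Mc M'(1) by simp
  finally have "A = M * B * M'" using AM by simp
  then have "similar_mat_wit A B M M'"
    using Ac Bc Mc M' by (intro similar_mat_witI[of _ _ m]) auto
  then show ?thesis
    using vs ws unfolding graph_similar_def enumerates_def similar_mat_def A_def B_def by blast
qed

section \<open>Adjacency entries\<close>

lemma adj_entry_commute: "adj_entry G u v = adj_entry G v u"
  by (simp add: adj_entry_def insert_commute)

lemma adj_entry_disjoint_union [simp]:
  fixes G :: "'a wgraph" and H :: "'b wgraph"
  shows "adj_entry (G \<union>\<^sub>G H) (Inl u) (Inl u') = adj_entry G u u'"
  "adj_entry (G \<union>\<^sub>G H) (Inr v) (Inr v') = adj_entry H v v'"
  "adj_entry (G \<union>\<^sub>G H) (Inl u) (Inr v) = 0"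
  "adj_entry (G \<union>\<^sub>G H) (Inr v) (Inl u) = 0"
proof -
  have l: "Inl ` e = {Inl u, Inl u' :: 'a + 'b} \<longleftrightarrow> e = {u, u'}" for e :: "'a set" and u u'
    using inj_image_eq_iff[of "Inl :: 'a \<Rightarrow> 'a + 'b" e "{u, u'}"] by simp
  have r: "Inr ` e = {Inr u, Inr u' :: 'a + 'b} \<longleftrightarrow> e = {u, u'}" for e :: "'b set" and u u'
    using inj_image_eq_iff[of "Inr :: 'b \<Rightarrow> 'a + 'b" e "{u, u'}"] by simp
  have lv: "Inl -` {Inl u, Inl u' :: 'a + 'b} = {u, u'}" for u u' by auto
  have rv: "Inr -` {Inr u, Inr u' :: 'a + 'b} = {u, u'}" for u u' by auto
  have "{Inl u, Inl u'} \<in> (`) Inl ` edges G \<union> (`) Inr ` edges H \<longleftrightarrow> {u, u'} \<in> edges G"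
    unfolding Un_iff image_iff using l by (metis insertI1 imageE Inl_Inr_False)
  then show "adj_entry (G \<union>\<^sub>G H) (Inl u) (Inl u') = adj_entry G u u'"
    by (simp add: adj_entry_def disjoint_union_def lv)
  have "{Inr v, Inr v'} \<in> (`) Inl ` edges G \<union> (`) Inr ` edges H \<longleftrightarrow> {v, v'} \<in> edges H"
    unfolding Un_iff image_iff using r by (metis insertI1 imageE Inr_Inl_False)
  then show "adj_entry (G \<union>\<^sub>G H) (Inr v) (Inr v') = adj_entry H v v'"
    by (auto simp add: adj_entry_def disjoint_union_def rv)
  have "{Inl u, Inr v} \<notin> (`) Inl ` edges G \<union> (`) Inr ` edges H" by blast
  then show "adj_entry (G \<union>\<^sub>G H) (Inl u) (Inr v) = 0"
    by (simp add: adj_entry_def disjoint_union_def)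
  then show "adj_entry (G \<union>\<^sub>G H) (Inr v) (Inl u) = 0"
    by (simp add: adj_entry_commute)
qed

lemma verts_disjoint_union [simp]: "verts (G \<union>\<^sub>G H) = verts G <+> verts H"
  by (simp add: disjoint_union_def)

abbreviation consecutive :: "nat \<Rightarrow> nat \<Rightarrow> bool" where
  "consecutive x y \<equiv> x = Suc y \<or> y = Suc x"

text \<open>Squares sharing a corner differ by at most one in each coordinate; the parity condition
  rules out a difference in exactly one of them.\<close>

lemma corners_meet_iff:
  assumes "even (x + y)" "even (x' + y')"
  shows "(x, y) \<noteq> (x', y') \<and> corners (x, y) \<inter> corners (x', y') \<noteq> {} \<longleftrightarrow>
    consecutive x x' \<and> consecutive y y'"
proof -
  have meet: "{x, x + 1} \<inter> {x', x' + 1} \<noteq> {} \<longleftrightarrow> x = x' \<or> consecutive x x'" for x x' :: nat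
    by auto
  have "corners (x, y) \<inter> corners (x', y') \<noteq> {} \<longleftrightarrow>
      (x = x' \<or> consecutive x x') \<and> (y = y' \<or> consecutive y y')"
    unfolding corners_def Times_Int_Times fst_conv snd_conv Times_empty
    using meet[of x x'] meet[of y y'] by blast
  then show ?thesis using assms by auto
qed

lemma adj_entry_OD:
  assumes "(x, y) \<in> black_squares n" "(x', y') \<in> black_squares n"
  shows "adj_entry (OD n) (x, y) (x', y') = of_bool (consecutive x x' \<and> consecutive y y')"
proof -
  have "{u, v} \<in> edges (OD n) \<longleftrightarrow> u \<noteq> v \<and> corners u \<inter> corners v \<noteq> {}"
    if "u \<in> black_squares n" "v \<in> black_squares n" for u v
  proof
    assume "{u, v} \<in> edges (OD n)"
    then obtain s t where "{u, v} = {s, t}" "s \<noteq> t" "corners s \<inter> corners t \<noteq> {}"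
      unfolding OD_def wgraph.simps by blast
    then show "u \<noteq> v \<and> corners u \<inter> corners v \<noteq> {}"
      unfolding doubleton_eq_iff by blast
  next
    assume "u \<noteq> v \<and> corners u \<inter> corners v \<noteq> {}"
    then show "{u, v} \<in> edges (OD n)"
      unfolding OD_def wgraph.simps using that by blast
  qed
  from this[OF assms] have "{(x, y), (x', y')} \<in> edges (OD n) \<longleftrightarrow>
      (x, y) \<noteq> (x', y') \<and> corners (x, y) \<inter> corners (x', y') \<noteq> {}" .
  also have "\<dots> \<longleftrightarrow> consecutive x x' \<and> consecutive y y'"
    using assms by (intro corners_meet_iff) (auto simp: black_squares_def)
  finally show ?thesis by (simp add: adj_entry_def OD_def)
qed

lemma verts_OD [simp]: "verts (OD n) = black_squares n"
  by (simp add: OD_def)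

lemma verts_HOD: "verts (HOD n) = {(x, y). x \<le> y \<and> y < 2 * n + 1 \<and> even (x + y)}"
  by (auto simp: HOD_def induced_def black_squares_def)

lemma adj_entry_HOD:
  assumes "(x, y) \<in> verts (HOD n)" "(x', y') \<in> verts (HOD n)"
  shows "adj_entry (HOD n) (x, y) (x', y') = of_bool (consecutive x x' \<and> consecutive y y')"
proof -
  have "adj_entry (HOD n) (x, y) (x', y') = adj_entry (OD n) (x, y) (x', y')"
    using assms by (auto simp: HOD_def induced_def adj_entry_def)
  then show ?thesis
    using assms by (subst adj_entry_OD[symmetric, of _ _ n]) (auto simp: HOD_def induced_def)
qed

lemma finite_black_squares: "finite (black_squares n)"
  by (rule finite_subset[of _ "{..<2 * n + 1} \<times> {..<2 * n + 1}"]) (auto simp: black_squares_def)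

lemma finite_verts_HOD: "finite (verts (HOD n))"
  using finite_black_squares[of n] by (simp add: HOD_def induced_def)

lemma verts_looped_path [simp]: "verts (add_loops c (path_graph n)) = {1..n}"
  by (simp add: add_loops_def path_graph_def)

lemma adj_entry_looped_path:
  assumes "i \<in> {1..n}" "j \<in> {1..n}"
  shows "adj_entry (add_loops c (path_graph n)) i j =
    (if i = j then c else of_bool (consecutive i j))"
proof -
  have "{i, j} \<in> edges (path_graph n) \<longleftrightarrow> consecutive i j"
    using assms by (auto simp: path_graph_def doubleton_eq_iff)
  moreover have "is_singleton {i, j} \<longleftrightarrow> i = j"
    by (auto simp: is_singleton_def)
  ultimately show ?thesis
    using assms by (auto simp: adj_entry_def add_loops_def path_graph_def)
qed

text \<open>The zero values at \<open>0\<close> and \<open>Suc n\<close> stand for the missing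
  neighbours of the two ends, so one three-term formula serves all \<open>j\<close>.\<close>

lemma sum_adj_entry_looped_path:
  assumes j: "j \<in> {1..n}" and f: "f 0 = 0" "f (Suc n) = 0"
  shows "(\<Sum>i=1..n. adj_entry (add_loops c (path_graph n)) i j * f i) =
    f (j - 1) + c * f j + f (Suc j)"
proof -
  have "(\<Sum>i=1..n. adj_entry (add_loops c (path_graph n)) i j * f i) =
      (\<Sum>i=1..n. (if i = j - 1 then f i else 0) + (if i = j then c * f i else 0) +
         (if i = Suc j then f i else 0))"
    using j by (intro sum.cong) (auto simp: adj_entry_looped_path)
  also have "\<dots> = f (j - 1) + c * f j + f (Suc j)"
    using j f by (cases "j = n"; cases "j = 1") (auto simp: sum.distrib)
  finally show ?thesis .
qed

section \<open>Matrices indexed by the vertices of a path\<close>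

text \<open>Matrices are total functions, so that the laws of the product need no dimension conditions; only
  the entries in \<open>{..<N} \<times> {..<N}\<close> are meaningful.\<close>

locale path_matrices =
  fixes N :: nat
begin

definition mm :: "(nat \<Rightarrow> nat \<Rightarrow> real) \<Rightarrow> (nat \<Rightarrow> nat \<Rightarrow> real) \<Rightarrow> nat \<Rightarrow> nat \<Rightarrow> real" (infixr "\<star>" 70) where
  "(F \<star> G) x y = (\<Sum>k<N. F x k * G k y)"

definition P :: "nat \<Rightarrow> nat \<Rightarrow> real" where
  "P x y = of_bool (x < N \<and> y < N \<and> consecutive x y)"

text \<open>Matrices living on the black squares. Vanishing off the board is included so that
  identities become equalities of total functions.\<close>

definition supported :: "(nat \<Rightarrow> nat \<Rightarrow> real) \<Rightarrow> bool" where
  "supported F \<longleftrightarrow> (\<forall>x y. F x y \<noteq> 0 \<longrightarrow> x < N \<and> y < N \<and> even (x + y))"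

text \<open>Multiplication by \<open>P\<close> on one side swaps the colours of the squares, whereas
  its square keeps them, so this commutator preserves \<open>supported\<close>.\<close>

definition comm :: "(nat \<Rightarrow> nat \<Rightarrow> real) \<Rightarrow> nat \<Rightarrow> nat \<Rightarrow> real" where
  "comm X x y = (P \<star> P \<star> X) x y - (X \<star> P \<star> P) x y"

section \<open>Algebra of the matrix product\<close>

lemma mm_assoc: "(F \<star> G) \<star> H = F \<star> G \<star> H"
proof (intro ext)
  fix x y
  have "((F \<star> G) \<star> H) x y = (\<Sum>k<N. \<Sum>l<N. F x l * G l k * H k y)"
    by (simp add: mm_def sum_distrib_right)
  also have "\<dots> = (\<Sum>l<N. \<Sum>k<N. F x l * G l k * H k y)"
    by (rule sum.swap)
  also have "\<dots> = (F \<star> G \<star> H) x y"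
    by (simp add: mm_def sum_distrib_left mult.assoc)
  finally show "((F \<star> G) \<star> H) x y = (F \<star> G \<star> H) x y" .
qed

lemma mm_transpose: "(F \<star> G) y x = ((\<lambda>x y. G y x) \<star> (\<lambda>x y. F y x)) x y"
  by (simp add: mm_def mult.commute)

lemma P_commute: "P x y = P y x"
  by (auto simp: P_def)

lemma P_transpose: "(\<lambda>x y. P y x) = P"
  by (intro ext) (rule P_commute)

lemma mm_sum_right:
  "F \<star> (\<lambda>x y. \<Sum>w\<in>W. c w * T w x y) = (\<lambda>x y. \<Sum>w\<in>W. c w * (F \<star> T w) x y)"
proof (intro ext)
  fix x y
  have "(F \<star> (\<lambda>x y. \<Sum>w\<in>W. c w * T w x y)) x y = (\<Sum>k<N. \<Sum>w\<in>W. c w * (F x k * T w k y))"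
    by (simp add: mm_def sum_distrib_left algebra_simps)
  also have "\<dots> = (\<Sum>w\<in>W. c w * (F \<star> T w) x y)"
    by (subst sum.swap) (simp add: mm_def sum_distrib_left)
  finally show "(F \<star> (\<lambda>x y. \<Sum>w\<in>W. c w * T w x y)) x y = (\<Sum>w\<in>W. c w * (F \<star> T w) x y)" .
qed

lemma mm_sum_left:
  "(\<lambda>x y. \<Sum>w\<in>W. c w * T w x y) \<star> F = (\<lambda>x y. \<Sum>w\<in>W. c w * (T w \<star> F) x y)"
proof (intro ext)
  fix x y
  have "((\<lambda>x y. \<Sum>w\<in>W. c w * T w x y) \<star> F) x y = (\<Sum>k<N. \<Sum>w\<in>W. c w * (T w x k * F k y))"
    by (simp add: mm_def sum_distrib_right mult.assoc)
  also have "\<dots> = (\<Sum>w\<in>W. c w * (T w \<star> F) x y)"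
    by (subst sum.swap) (simp add: mm_def sum_distrib_left)
  finally show "((\<lambda>x y. \<Sum>w\<in>W. c w * T w x y) \<star> F) x y = (\<Sum>w\<in>W. c w * (T w \<star> F) x y)" .
qed

lemma mm_add_right: "F \<star> (\<lambda>x y. G x y + H x y) = (\<lambda>x y. (F \<star> G) x y + (F \<star> H) x y)"
  by (intro ext) (simp add: mm_def algebra_simps sum.distrib)

lemma mm_add_left: "(\<lambda>x y. G x y + H x y) \<star> F = (\<lambda>x y. (G \<star> F) x y + (H \<star> F) x y)"
  by (intro ext) (simp add: mm_def algebra_simps sum.distrib)

lemma mm_diff_right: "F \<star> (\<lambda>x y. G x y - H x y) = (\<lambda>x y. (F \<star> G) x y - (F \<star> H) x y)"
  by (intro ext) (simp add: mm_def algebra_simps sum_subtractf)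

lemma mm_diff_left: "(\<lambda>x y. G x y - H x y) \<star> F = (\<lambda>x y. (G \<star> F) x y - (H \<star> F) x y)"
  by (intro ext) (simp add: mm_def algebra_simps sum_subtractf)

lemma mm_scale_right: "F \<star> (\<lambda>x y. c * G x y) = (\<lambda>x y. c * (F \<star> G) x y)"
  by (intro ext) (simp add: mm_def algebra_simps sum_distrib_left)

lemma mm_scale_left: "(\<lambda>x y. c x * G x y) \<star> F = (\<lambda>x y. c x * (G \<star> F) x y)"
  by (intro ext) (simp add: mm_def algebra_simps sum_distrib_left)

lemma mm_zero [simp]: "F \<star> (\<lambda>x y. 0) = (\<lambda>x y. 0)" "(\<lambda>x y. 0) \<star> F = (\<lambda>x y. 0)"
  by (intro ext; simp add: mm_def)+

lemma P_mm:
  "(P \<star> F) x y =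
    (if x < N then (if x > 0 then F (x - 1) y else 0) + (if Suc x < N then F (Suc x) y else 0) else 0)"
proof -
  have "(P \<star> F) x y = (\<Sum>k<N. (if x < N \<and> 0 < x \<and> k = x - 1 then F k y else 0) +
      (if x < N \<and> k = Suc x then F k y else 0))"
    unfolding mm_def by (intro sum.cong) (auto simp: P_def)
  also have "\<dots> = (\<Sum>k<N. if x < N \<and> 0 < x \<and> k = x - 1 then F k y else 0) +
      (\<Sum>k<N. if x < N \<and> k = Suc x then F k y else 0)"
    by (rule sum.distrib)
  also have "\<dots> = (if x < N then (if x > 0 then F (x - 1) y else 0) + (if Suc x < N then F (Suc x) y else 0) else 0)"
    by auto
  finally show ?thesis .
qed

lemma mm_P:
  "(F \<star> P) x y =
    (if y < N then (if y > 0 then F x (y - 1) else 0) + (if Suc y < N then F x (Suc y) else 0) else 0)"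
  by (subst mm_transpose) (simp add: P_transpose P_mm)

lemma comm_sum: "comm (\<lambda>x y. \<Sum>w\<in>W. c w * T w x y) = (\<lambda>x y. \<Sum>w\<in>W. c w * comm (T w) x y)"
  unfolding comm_def mm_sum_right mm_sum_left by (simp add: sum_subtractf algebra_simps)

lemma comm_add: "comm (\<lambda>x y. F x y + G x y) = (\<lambda>x y. comm F x y + comm G x y)"
  unfolding comm_def mm_add_right mm_add_left by (simp add: algebra_simps)

text \<open>By associativity, as \<open>P\<close> commutes with its own square.\<close>

lemma P_comm_P: "P \<star> comm X \<star> P = comm (P \<star> X \<star> P)"
proof -
  have c: "comm X = (\<lambda>x y. (P \<star> P \<star> X) x y - (X \<star> P \<star> P) x y)" for X
    by (intro ext) (simp add: comm_def)
  show ?thesis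
    unfolding c mm_diff_right mm_diff_left by (simp add: mm_assoc)
qed

section \<open>The square of the path matrix and the black squares\<close>

lemma supported_zero: "supported F \<Longrightarrow> \<not> (x < N \<and> y < N \<and> even (x + y)) \<Longrightarrow> F x y = 0"
  unfolding supported_def by blast

text \<open>The coefficient of the middle term is the degree of \<open>x\<close> in the
  path.\<close>

lemma PP_mm:
  assumes "x < N"
  shows "(P \<star> P \<star> F) x y = (if 2 \<le> x then F (x - 2) y else 0) +
    (of_bool (0 < x) + of_bool (Suc x < N)) * F x y + (if x + 2 < N then F (x + 2) y else 0)"
proof -
  consider "x = 0" | "x = 1" | z where "x = Suc (Suc z)"
    by (metis One_nat_def not0_implies_Suc)
  then show ?thesis using assms by cases (auto simp: P_mm)
qed

lemma mm_PP: "(F \<star> P \<star> P) x y = (P \<star> P \<star> (\<lambda>x y. F y x)) y x"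
proof -
  have "(\<lambda>x y. (F \<star> P) y x) = P \<star> (\<lambda>x y. F y x)"
    by (intro ext) (subst mm_transpose, simp add: P_transpose)
  then show ?thesis
    unfolding mm_assoc[symmetric, of F] by (subst mm_transpose) (simp add: P_transpose)
qed

lemma supported_PP_mm:
  assumes "supported F" shows "supported (P \<star> P \<star> F)"
  unfolding supported_def
proof (intro allI impI)
  fix x y assume nz: "(P \<star> P \<star> F) x y \<noteq> 0"
  then have x: "x < N" by (auto simp: P_mm split: if_splits)
  show "x < N \<and> y < N \<and> even (x + y)"
  proof (rule ccontr)
    assume "\<not> ?thesis"
    then have "F x' y = 0" if "even (x + x')" for x'
      using x that by (intro supported_zero[OF assms]) presburger
    then have "(P \<star> P \<star> F) x y = 0"
      unfolding PP_mm[OF x] by simp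
    with nz show False by simp
  qed
qed

lemma supported_transpose: "supported F \<Longrightarrow> supported (\<lambda>x y. F y x)"
  unfolding supported_def by (metis add.commute)

lemma supported_mm_PP:
  assumes "supported F" shows "supported (F \<star> P \<star> P)"
proof -
  have "F \<star> P \<star> P = (\<lambda>x y. (P \<star> P \<star> (\<lambda>x y. F y x)) y x)"
    by (intro ext) (rule mm_PP)
  then show ?thesis
    using supported_transpose[OF supported_PP_mm[OF supported_transpose[OF assms]]] by simp
qed

lemma supported_comm:
  assumes "supported F" shows "supported (comm F)"
  using supported_PP_mm[OF assms] supported_mm_PP[OF assms]
  unfolding supported_def comm_def by (metis diff_0_right)

section \<open>Frobenius inner product and self-adjointness of the commutator\<close>

definition inner :: "(nat \<Rightarrow> nat \<Rightarrow> real) \<Rightarrow> (nat \<Rightarrow> nat \<Rightarrow> real) \<Rightarrow> real" where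
  "inner F G = (\<Sum>x<N. \<Sum>y<N. F x y * G x y)"

lemma inner_transpose: "inner (\<lambda>x y. F y x) (\<lambda>x y. G y x) = inner F G"
  unfolding inner_def by (rule sum.swap)

lemma inner_P_mm: "inner (P \<star> F) G = inner F (P \<star> G)"
proof -
  have "inner (P \<star> F) G = (\<Sum>x<N. \<Sum>y<N. \<Sum>k<N. P x k * F k y * G x y)"
    by (simp add: inner_def mm_def sum_distrib_right)
  also have "\<dots> = (\<Sum>x<N. \<Sum>k<N. \<Sum>y<N. P x k * F k y * G x y)"
    by (rule sum.cong[OF refl], rule sum.swap)
  also have "\<dots> = (\<Sum>k<N. \<Sum>x<N. \<Sum>y<N. P x k * F k y * G x y)"
    by (rule sum.swap)
  also have "\<dots> = (\<Sum>k<N. \<Sum>y<N. \<Sum>x<N. P x k * F k y * G x y)"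
    by (rule sum.cong[OF refl], rule sum.swap)
  also have "\<dots> = inner F (P \<star> G)"
    unfolding inner_def mm_def sum_distrib_left
    by (intro sum.cong refl) (subst P_commute, simp)
  finally show ?thesis .
qed

lemma inner_mm_P: "inner (F \<star> P) G = inner F (G \<star> P)"
proof -
  have t: "(\<lambda>x y. (H \<star> P) y x) = P \<star> (\<lambda>x y. H y x)" for H
    by (intro ext) (subst mm_transpose, simp add: P_transpose)
  have "inner (F \<star> P) G = inner (\<lambda>x y. (F \<star> P) y x) (\<lambda>x y. G y x)"
    by (rule inner_transpose[symmetric])
  also have "\<dots> = inner (\<lambda>x y. F y x) (\<lambda>x y. (G \<star> P) y x)"
    unfolding t by (rule inner_P_mm)
  also have "\<dots> = inner F (G \<star> P)"
    by (rule inner_transpose)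
  finally show ?thesis .
qed

text \<open>\<open>P\<close> is symmetric, so left and right multiplication by its square are both
  self-adjoint.\<close>

lemma inner_comm: "inner (comm F) G = inner F (comm G)"
proof -
  have l: "inner (comm F) G = inner (P \<star> P \<star> F) G - inner ((F \<star> P) \<star> P) G" for F G
    by (simp add: inner_def comm_def mm_assoc algebra_simps sum_subtractf)
  have r: "inner F (comm G) = inner F (P \<star> P \<star> G) - inner F ((G \<star> P) \<star> P)" for F G
    by (simp add: inner_def comm_def mm_assoc algebra_simps sum_subtractf)
  show ?thesis unfolding l r inner_P_mm inner_mm_P ..
qed

text \<open>A self-adjoint operator has the same kernel as its square:
  \<open>inner (comm X) (comm X)\<close>, a sum of squares, equals
  \<open>inner X (comm (comm X))\<close>.\<close>

lemma comm_comm_eq_zero: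
  assumes "supported X" "comm (comm X) = (\<lambda>x y. 0)"
  shows "comm X = (\<lambda>x y. 0)"
proof (intro ext)
  fix x y
  have "inner (comm X) (comm X) = 0"
    unfolding inner_comm assms(2) by (simp add: inner_def)
  then have "\<forall>x<N. \<forall>y<N. comm X x y = 0"
    unfolding inner_def by (simp add: sum_nonneg_eq_0_iff sum_nonneg)
  then show "comm X x y = 0"
    using supported_zero[OF supported_comm[OF assms(1)]] by blast
qed

text \<open>The hypothesis is a discrete wave equation for \<open>X\<close>, which carries the vanishing on the
  diagonal to the second, fourth and further even off-diagonals, along each of which the entries propagate
  from the border.\<close>

lemma antisym_comm_eq_zero:
  assumes supp: "supported X" and anti: "\<And>x y. X y x = - X x y"
    and comm: "comm X = (\<lambda>x y. 0)"
  shows "X = (\<lambda>x y. 0)"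
proof -
  \<comment> \<open>Antisymmetry turns the right product at \<open>(x, y)\<close> into minus the
    left product at \<open>(y, x)\<close>.\<close>
  have "comm X x y = (P \<star> P \<star> X) x y + (P \<star> P \<star> X) y x" for x y
  proof -
    have "(\<lambda>x y. X y x) = (\<lambda>x y. - 1 * X x y)"
      by (intro ext) (use anti in \<open>metis mult_minus1\<close>)
    then show ?thesis
      unfolding comm_def mm_PP by (simp only: mm_scale_right)
  qed
  then have wave: "(P \<star> P \<star> X) x y + (P \<star> P \<star> X) y x = 0" for x y
    using comm by (metis (no_types))
  have off: "X x (x + d) = 0" for x d
  proof (induction d arbitrary: x rule: less_induct)
    case (less d)
    \<comment> \<open>The outer induction covers the whole band strictly between the two
      off-diagonals at distance \<open>d\<close>.\<close>
    have near: "X x y = 0" if "x < y + d" "y < x + d" for x y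
      using less.IH[of "y - x" x] less.IH[of "x - y" y] anti[of x y] that
      by (cases "x \<le> y") auto
    consider "d = 0" | "odd d" | "2 \<le> d" "even d"
      by (metis One_nat_def even_zero less_2_cases not_less odd_one)
    then show ?case
    proof cases
      case 1 then show ?thesis using anti[of x x] by simp
    next
      case 2 then show ?thesis by (intro supported_zero[OF supp]) simp
    next
      case 3
      show ?thesis
      proof (induction x rule: less_induct)
        case (less x)
        show ?case
        proof (cases "x + d < N")
          case False then show ?thesis by (intro supported_zero[OF supp]) simp
        next
          case True
          \<comment> \<open>The wave equation is used at \<open>(x, y)\<close> on off-diagonal
            \<open>d - 2\<close>, whose neighbour \<open>(x, y + 2)\<close> is the entry
            sought.\<close>
          define y where "y = x + d - 2"
          have y: "y + 2 = x + d" "x \<le> y" using 3 by (auto simp: y_def)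
          have lt: "x < N" "y < N" using True 3 by (auto simp: y_def)
          have eq: "(if 2 \<le> x then X (x - 2) y else 0) + (if x + 2 < N then X (x + 2) y else 0)
            + ((if 2 \<le> y then X (y - 2) x else 0) + X (y + 2) x) = 0"
            using wave[of x y] near[of x y] near[of y x] y True
            unfolding PP_mm[OF lt(1)] PP_mm[OF lt(2)] by auto
          \<comment> \<open>This entry is also on off-diagonal \<open>d\<close>, in an earlier row;
            in the first two rows the term is absent, which starts the propagation.\<close>
          have 1: "X (x - 2) y = 0" if "2 \<le> x"
          proof -
            have "x - 2 + d = y" using that y by simp
            then show ?thesis using less.IH[of "x - 2"] that by simp
          qed
          show ?thesis
          \<comment> \<open>For \<open>d = 2\<close> the point is on the diagonal and the equation
            merely counts each term twice. Otherwise the two remaining unwanted terms are, up to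
            transposition, on off-diagonal \<open>d - 4\<close>.\<close>
          proof (cases "d = 2")
            case True
            then have "y = x" using y by simp
            then show ?thesis
              using eq 1 anti[of x "x + 2"] True \<open>x + d < N\<close> by (auto split: if_splits)
          next
            case False
            then have "4 \<le> d" using 3 by presburger
            then have "X (x + 2) y = 0" "2 \<le> y \<Longrightarrow> X (y - 2) x = 0"
              using y by (auto intro!: near)
            then have "X (y + 2) x = 0" using eq 1 by (auto split: if_splits)
            then show ?thesis using anti[of x "x + d"] y by simp
          qed
        qed
      qed
    qed
  qed
  show ?thesis
  proof (intro ext)
    fix x y show "X x y = 0"
      using off[of x "y - x"] off[of y "x - y"] anti[of x y] by (cases "x \<le> y") auto
  qed
qed

text \<open>\<open>X\<close> is antisymmetric while \<open>comm Y\<close> and \<open>C\<close> are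
  symmetric, so \<open>X\<close> separates. Applying \<open>comm\<close> to the rest kills
  \<open>C\<close> and leaves \<open>comm (comm Y) = 0\<close>, whence \<open>comm Y = 0\<close> and
  then \<open>Y = 0\<close>.\<close>

lemma independent:
  assumes X: "supported X" "\<And>x y. X y x = - X x y"
    and Y: "supported Y" "\<And>x y. Y y x = - Y x y"
    and C: "\<And>x y. C y x = C x y" "comm C = (\<lambda>x y. 0)"
    and sum: "\<And>x y. X x y + comm Y x y + C x y = 0"
  shows "X = (\<lambda>x y. 0)" "Y = (\<lambda>x y. 0)" "C = (\<lambda>x y. 0)"
proof -
  have sym: "comm Y y x = comm Y x y" for x y
  proof -
    have "(\<lambda>x y. Y y x) = (\<lambda>x y. - 1 * Y x y)"
      by (intro ext) (use Y(2) in \<open>metis mult_minus1\<close>)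
    then show ?thesis
      unfolding comm_def mm_PP by (simp only: mm_scale_right)
  qed
  show X0: "X = (\<lambda>x y. 0)"
  proof (intro ext)
    fix x y show "X x y = 0"
      using sum[of x y] sum[of y x] sym[of x y] X(2)[of x y] C(1)[of x y] by simp
  qed
  have YC: "comm Y x y + C x y = 0" for x y using sum[of x y] X0 by simp
  have "comm (\<lambda>x y. comm Y x y + C x y) = (\<lambda>x y. comm (comm Y) x y)"
    unfolding comm_add C(2) by simp
  moreover have "comm (\<lambda>x y. comm Y x y + C x y) = (\<lambda>x y. 0)"
    unfolding YC by (intro ext) (simp add: comm_def)
  ultimately have Y0: "comm Y = (\<lambda>x y. 0)"
    by (intro comm_comm_eq_zero[OF Y(1)]) simp
  show "Y = (\<lambda>x y. 0)" by (rule antisym_comm_eq_zero[OF Y Y0])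
  show "C = (\<lambda>x y. 0)"
  proof (intro ext)
    fix x y show "C x y = 0" using YC[of x y] unfolding Y0 by simp
  qed
qed

section \<open>Chebyshev polynomials of the path matrix\<close>

definition idm :: "nat \<Rightarrow> nat \<Rightarrow> real" where
  "idm x y = of_bool (x = y \<and> x < N)"

text \<open>Shifted by one: \<open>U k\<close> is the Chebyshev polynomial of the second kind of degree \<open>k - 1\<close>, normalised
  as \<open>sin (k t) / sin t\<close> at \<open>2 cos t\<close> and evaluated at \<open>P\<close>.\<close>

fun U :: "nat \<Rightarrow> nat \<Rightarrow> nat \<Rightarrow> real" where
  "U 0 = (\<lambda>x y. 0)"
| "U (Suc 0) = idm"
| "U (Suc (Suc k)) = (\<lambda>x y. (P \<star> U (Suc k)) x y - U k x y)"

lemma P_U: "P \<star> U (Suc k) = (\<lambda>x y. U k x y + U (Suc (Suc k)) x y)"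
  by simp

lemma P_idm: "P \<star> idm = P" "idm \<star> P = P"
proof -
  show "P \<star> idm = P"
  proof (intro ext)
    fix x y
    have "(P \<star> idm) x y = (\<Sum>k<N. if k = y then P x k else 0)"
      unfolding mm_def by (intro sum.cong) (auto simp: idm_def)
    then show "(P \<star> idm) x y = P x y" by (simp add: P_def)
  qed
  show "idm \<star> P = P"
  proof (intro ext)
    fix x y
    have "(idm \<star> P) x y = (\<Sum>k<N. if k = x then P k y else 0)"
      unfolding mm_def by (intro sum.cong) (auto simp: idm_def)
    then show "(idm \<star> P) x y = P x y" by (simp add: P_def)
  qed
qed

lemma U_P_commute: "U k \<star> P = P \<star> U k"
proof (induction k rule: U.induct)
  case (3 k)
  show ?case
    unfolding U.simps mm_diff_left mm_diff_right mm_assoc 3 ..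
qed (simp_all add: P_idm)

lemma U_sym: "U k y x = U k x y"
proof (induction k arbitrary: x y rule: U.induct)
  case (3 k)
  have t: "(\<lambda>x y. U (Suc k) y x) = U (Suc k)"
    by (intro ext) (rule 3(1))
  have "(P \<star> U (Suc k)) y x = (P \<star> U (Suc k)) x y"
    unfolding mm_transpose[of P _ y x] t P_transpose U_P_commute ..
  moreover have "U k y x = U k x y" by (rule 3(2))
  ultimately show ?case unfolding U.simps by (rule arg_cong2[of _ _ _ _ minus])
qed (auto simp: idm_def)

text \<open>\<open>U k\<close> is a polynomial in \<open>P\<close> whose exponents all have the
  parity of \<open>k - 1\<close>, and each factor \<open>P\<close> changes the parity of
  \<open>x + y\<close>.\<close>

lemma U_nonzero: "U k x y \<noteq> 0 \<Longrightarrow> x < N \<and> y < N \<and> odd (x + y + k)"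
proof (induction k arbitrary: x y rule: U.induct)
  case (3 k)
  show ?case
  proof (cases "U k x y = 0")
    case True
    then have "(P \<star> U (Suc k)) x y \<noteq> 0" using 3(3) by simp
    then obtain x' where "x < N" "consecutive x x'" "U (Suc k) x' y \<noteq> 0"
      unfolding mm_def P_def by (auto elim!: sum.not_neutral_contains_not_neutral split: if_splits)
    then show ?thesis using 3(1)[of x' y] by auto
  qed (use 3(2)[of x y] in simp)
qed (auto simp: idm_def split: if_splits)

text \<open>The Chebyshev recurrence is the one obeyed by the basis vectors along the path, so
  \<open>U k\<close> sends the first of them to the \<open>k\<close>-th. At \<open>k = Suc N\<close>
  the path has ended and the row is zero.\<close>

lemma U_first_row:
  assumes "k \<le> Suc N"
  shows "U k 0 y = of_bool (Suc y = k \<and> y < N)"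
  using assms
proof (induction k arbitrary: y rule: U.induct)
  case (3 k)
  have k: "k < N" "Suc k \<le> Suc N" using 3(3) by auto
  have "(P \<star> U (Suc k)) 0 y = (U (Suc k) \<star> P) 0 y" by (simp only: U_P_commute)
  also have "\<dots> = (\<Sum>j<N. if j = k then P k y else 0)"
    unfolding mm_def 3(1)[OF k(2)] by (intro sum.cong) auto
  also have "\<dots> = of_bool (y < N \<and> consecutive y k)"
    using k by (auto simp: P_def)
  finally have "(P \<star> U (Suc k)) 0 y = of_bool (y < N \<and> consecutive y k)" .
  moreover have "U k 0 y = of_bool (Suc y = k \<and> y < N)" using 3(2,3) by simp
  ultimately show ?case using 3(3) unfolding U.simps by auto
qed (auto simp: idm_def)

text \<open>This is Cayley-Hamilton for the path: the polynomial of degree \<open>N\<close> is its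
  characteristic polynomial. Here the zero first row spreads to all rows because
  \<open>U (Suc N)\<close> commutes with \<open>P\<close>.\<close>

lemma U_last: "U (Suc N) = (\<lambda>x y. 0)"
proof -
  have "U (Suc N) x y = 0" for x y
  proof (induction x arbitrary: y rule: less_induct)
    case (less x)
    show ?case
    proof (cases x)
      case 0 then show ?thesis by (simp add: U_first_row)
    next
      case (Suc z)
      \<comment> \<open>Row \<open>z\<close> of this identity involves row \<open>Suc z\<close> once
        and otherwise only rows up to \<open>z\<close>.\<close>
      have "(P \<star> U (Suc N)) z y = (U (Suc N) \<star> P) z y" by (simp only: U_P_commute)
      then show ?thesis
        using less.IH Suc U_nonzero[of "Suc N" x y] unfolding P_mm mm_P
        by (auto split: if_splits simp del: U.simps)
    qed
  qed
  then show ?thesis by (intro ext)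
qed

end

text \<open>The solution starting at zero is \<open>(-1) ^ i * i * c\<close>, which vanishes at
  \<open>Suc n\<close> only for \<open>c = 0\<close>.\<close>

lemma alternating_recurrence:
  fixes f :: "nat \<Rightarrow> real"
  assumes "f 0 = 0" "f (Suc n) = 0" and rec: "\<And>i. i \<le> n \<Longrightarrow> f (Suc i) + f i + c * (-1) ^ i = 0"
  shows "c = 0" "i \<le> n \<Longrightarrow> f i = 0"
proof -
  have f: "f i = (-1) ^ i * real i * c" if "i \<le> Suc n" for i
    using that
  proof (induction i)
    case (Suc i)
    then show ?case using rec[of i] by (simp add: algebra_simps)
  qed (simp add: assms)
  from f[of "Suc n"] show "c = 0" using assms(2) by simp
  with f show "f i = 0" if "i \<le> n" using that by simp
qed

lemma second_order_recurrence:
  fixes f :: "nat \<Rightarrow> real"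
  assumes f: "f 0 = 0" "f (Suc n) = 0"
    and rec: "\<And>i. i < n \<Longrightarrow> f i + 2 * f (Suc i) + f (Suc (Suc i)) = 0" and "i \<le> n"
  shows "f i = 0"
proof -
  \<comment> \<open>Sums of consecutive values alternate in sign, which reduces the claim to the
    previous recurrence with \<open>c = - f 1\<close>.\<close>
  have "f (Suc i) + f i + (- f 1) * (-1) ^ i = 0" if "i \<le> n" for i
    using that
  proof (induction i)
    case (Suc i)
    then show ?case using rec[of i] by simp
  qed (simp add: f)
  then show ?thesis
    using alternating_recurrence(2)[OF f] \<open>i \<le> n\<close> by blast
qed

section \<open>Matrices commuting with the square of the path matrix\<close>

context path_matrices begin

text \<open>The product of the column \<open>(1, 0, -1, 0, 1, ...)\<close> with its transpose; for
  odd \<open>N\<close> this column is the null vector of \<open>P\<close>.\<close>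

definition K :: "nat \<Rightarrow> nat \<Rightarrow> real" where
  "K x y = (if x < N \<and> y < N \<and> even x \<and> even y then (-1) ^ ((x + y) div 2) else 0)"

text \<open>An even polynomial in \<open>P\<close>, hence supported on the black squares. Both
  \<open>F 0\<close> and, for \<open>N = 2 * n + 1\<close>, \<open>F (Suc n)\<close> vanish, as the
  ends of a path on \<open>n\<close> vertices require.\<close>

definition F :: "nat \<Rightarrow> nat \<Rightarrow> nat \<Rightarrow> real" where
  "F j = P \<star> U (2 * j)"

text \<open>The row signs negate the action of \<open>P\<close> from the left; the sign
  \<open>(-1) ^ j\<close> restores the weight \<open>1\<close> between neighbouring indices, so only
  the loop changes sign.\<close>

definition F' :: "nat \<Rightarrow> nat \<Rightarrow> nat \<Rightarrow> real" where
  "F' j x y = (-1) ^ j * ((-1) ^ x * F j x y)"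

lemma K_sym: "K y x = K x y"
  by (simp add: K_def add.commute)

lemma K_supported: "supported K"
  by (auto simp: supported_def K_def split: if_splits)

lemma P_K:
  assumes "odd N" shows "P \<star> K = (\<lambda>x y. 0)"
proof (intro ext)
  fix x y
  show "(P \<star> K) x y = 0"
  proof (cases "x < N \<and> odd x")
    case False
    then show ?thesis by (auto simp: P_mm K_def)
  next
    case True
    then obtain z where z: "x = Suc (2 * z)" by (metis oddE Suc_eq_plus1)
    \<comment> \<open>As \<open>N\<close> is odd, an odd \<open>x\<close> is not the last vertex: it
      has two neighbours, and their entries cancel.\<close>
    then have "Suc x < N" using True assms by (metis Suc_lessI even_Suc)
    then show ?thesis using z by (auto simp: P_mm K_def elim!: evenE)
  qed
qed

lemma K_P:
  assumes "odd N" shows "K \<star> P = (\<lambda>x y. 0)"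
proof -
  have "(\<lambda>x y. K y x) = K" by (intro ext) (rule K_sym)
  then show ?thesis
    by (intro ext) (simp only: mm_transpose[of K P] P_transpose P_K[OF assms])
qed

lemma comm_K:
  assumes "odd N" shows "comm K = (\<lambda>x y. 0)"
  by (intro ext) (simp add: comm_def P_K K_P assms mm_assoc[symmetric, of K])

lemma F_P: "F j \<star> P = P \<star> F j"
  unfolding F_def mm_assoc U_P_commute ..

lemma F_sym: "F j y x = F j x y"
proof -
  have "(\<lambda>x y. U (2 * j) y x) = U (2 * j)" by (intro ext) (rule U_sym)
  then show ?thesis
    unfolding F_def mm_transpose[of P _ y x] by (simp only: P_transpose U_P_commute)
qed

lemma F_supported: "supported (F j)"
  unfolding supported_def
proof (intro allI impI)
  fix x y assume "F j x y \<noteq> 0"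
  then obtain x' where "P x x' * U (2 * j) x' y \<noteq> 0"
    unfolding F_def mm_def by (metis (no_types, lifting) sum.neutral)
  then show "x < N \<and> y < N \<and> even (x + y)"
    using U_nonzero[of "2 * j" x' y] by (auto simp: P_def split: if_splits)
qed

lemma F_zero [simp]: "F 0 = (\<lambda>x y. 0)"
  by (simp add: F_def)

lemma F_last:
  assumes "N = Suc (2 * n)" shows "F (Suc n) = (\<lambda>x y. 0)"
proof -
  have "2 * Suc n = Suc N" using assms by simp
  then show ?thesis by (simp only: F_def U_last mm_zero)
qed

lemma PP_U:
  "P \<star> P \<star> U (Suc (Suc k)) = (\<lambda>x y. U k x y + 2 * U (Suc (Suc k)) x y + U (Suc (Suc (Suc (Suc k)))) x y)"
  unfolding P_U mm_add_right by (intro ext) (simp only: P_U)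

lemma PP_F: "P \<star> P \<star> F (Suc j) = (\<lambda>x y. F j x y + 2 * F (Suc j) x y + F (Suc (Suc j)) x y)"
proof -
  have "P \<star> P \<star> F (Suc j) = P \<star> P \<star> P \<star> U (Suc (Suc (2 * j)))"
    by (simp only: F_def mult_Suc_right add_2_eq_Suc)
  also have "\<dots> = (\<lambda>x y. F j x y + 2 * F (Suc j) x y + F (Suc (Suc j)) x y)"
    unfolding PP_U mm_add_right mm_scale_right by (simp only: F_def mult_Suc_right add_2_eq_Suc)
  finally show ?thesis .
qed

text \<open>\<open>F j\<close> commutes with \<open>P\<close>, so the two-sided action is
  multiplication by the square. Two Chebyshev steps reach the middle index in two ways, which is the
  loop weight \<open>2\<close>.\<close>

lemma P_F_P: "P \<star> F (Suc j) \<star> P = (\<lambda>x y. F j x y + 2 * F (Suc j) x y + F (Suc (Suc j)) x y)"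
  unfolding F_P by (rule PP_F)

lemma F_row_0:
  assumes "N = Suc (2 * n)" "j \<in> {1..n}" "y < N"
  shows "F j 0 y = of_bool (y + 2 = 2 * j) + of_bool (y = 2 * j)"
proof -
  obtain i where i: "j = Suc i" using assms(2) by (cases j) auto
  have "F j = (\<lambda>x y. U (Suc (2 * i)) x y + U (Suc (Suc (Suc (2 * i)))) x y)"
    unfolding F_def i mult_Suc_right add_2_eq_Suc by (rule P_U)
  moreover have "Suc (2 * i) \<le> Suc N" "Suc (Suc (Suc (2 * i))) \<le> Suc N"
    using assms i by auto
  ultimately show ?thesis
    using assms(3) i by (simp add: U_first_row del: U.simps)
qed

lemma F_row_1:
  assumes "N = Suc (2 * n)" "j \<in> {1..n}" "y < N"
  shows "F j 1 y = of_bool (y + 3 = 2 * j) + 2 * of_bool (y + 1 = 2 * j) + of_bool (y = 2 * j + 1)"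
proof -
  obtain i where i: "j = Suc i" using assms(2) by (cases j) auto
  have "1 < N" using assms by auto
  \<comment> \<open>Vertex \<open>0\<close> has \<open>1\<close> as its only neighbour.\<close>
  then have "F j 1 y = (P \<star> F j) 0 y" by (simp add: P_mm)
  also have "\<dots> = (P \<star> P \<star> U (Suc (Suc (2 * i)))) 0 y"
    unfolding F_def i mult_Suc_right add_2_eq_Suc ..
  also have "\<dots> = of_bool (y + 3 = 2 * j) + 2 * of_bool (y + 1 = 2 * j) + of_bool (y = 2 * j + 1)"
  proof -
    have "2 * i \<le> Suc N" "Suc (Suc (2 * i)) \<le> Suc N" "Suc (Suc (Suc (Suc (2 * i)))) \<le> Suc N"
      using assms i by auto
    then show ?thesis
      unfolding PP_U using assms(3) i by (simp add: U_first_row del: U.simps)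
  qed
  finally show ?thesis .
qed

text \<open>Edges of the path join vertices of opposite parity, so the row signs anticommute with
  \<open>P\<close>.\<close>

lemma P_alternate: "P \<star> (\<lambda>x y. (-1) ^ x * G x y) = (\<lambda>x y. - ((-1) ^ x * (P \<star> G) x y))"
proof (intro ext)
  fix x y
  show "(P \<star> (\<lambda>x y. (-1) ^ x * G x y)) x y = - ((-1) ^ x * (P \<star> G) x y)"
    by (cases x) (simp_all add: P_mm algebra_simps)
qed

lemma P_minus: "P \<star> (\<lambda>x y. - G x y) = (\<lambda>x y. - (P \<star> G) x y)"
  by (intro ext) (simp add: mm_def sum_negf)

lemma P_F'_P:
  "P \<star> F' (Suc j) \<star> P = (\<lambda>x y. F' j x y - 2 * F' (Suc j) x y + F' (Suc (Suc j)) x y)"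
proof -
  have "F' (Suc j) = (\<lambda>x y. (-1) ^ Suc j * ((-1) ^ x * F (Suc j) x y))"
    by (intro ext) (simp add: F'_def)
  then have "P \<star> F' (Suc j) \<star> P = (\<lambda>x y. (-1) ^ Suc j * - ((-1) ^ x * (P \<star> F (Suc j) \<star> P) x y))"
    by (simp only: mm_scale_left mm_scale_right P_alternate)
  then show ?thesis
    unfolding P_F_P by (intro ext) (simp add: F'_def algebra_simps)
qed

text \<open>On the black squares \<open>x\<close> and \<open>y\<close> have the same parity, so row
  signs and column signs agree.\<close>

lemma F'_sym: "F' j y x = F' j x y"
proof (cases "F j x y = 0")
  case True then show ?thesis using F_sym[of j x y] by (simp add: F'_def)
next
  case False
  then have "even (x + y)" using F_supported[of j] unfolding supported_def by blast
  then have "(-1) ^ x = ((-1) ^ y :: real)" by (auto simp: minus_one_power_iff)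
  then show ?thesis using F_sym[of j x y] by (simp add: F'_def)
qed

lemma F'_supported: "supported (F' j)"
  using F_supported[of j] by (simp add: supported_def F'_def)

lemma F'_zero [simp]: "F' 0 = (\<lambda>x y. 0)"
  by (intro ext) (simp add: F'_def)

lemma F'_last:
  assumes "N = Suc (2 * n)" shows "F' (Suc n) = (\<lambda>x y. 0)"
  by (intro ext) (simp only: F'_def F_last[OF assms] mult_zero_right)

lemma comm_F: "comm (F j) = (\<lambda>x y. 0)"
  by (intro ext) (simp add: comm_def F_P mm_assoc[symmetric, of "F j"] mm_assoc[of P "F j"])

text \<open>The row signs anticommute with \<open>P\<close> and hence commute with its
  square.\<close>

lemma comm_F': "comm (F' j) = (\<lambda>x y. 0)"
proof -
  have f: "F' j = (\<lambda>x y. (-1) ^ j * ((-1) ^ x * F j x y))"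
    by (intro ext) (simp add: F'_def)
  have "P \<star> P \<star> F' j = (\<lambda>x y. (-1) ^ j * ((-1) ^ x * (P \<star> P \<star> F j) x y))"
    unfolding f mm_scale_right P_alternate P_minus by simp
  moreover have "F' j \<star> P \<star> P = (\<lambda>x y. (-1) ^ j * ((-1) ^ x * (F j \<star> P \<star> P) x y))"
    unfolding f mm_scale_left ..
  moreover have "F j \<star> P \<star> P = P \<star> P \<star> F j"
    by (simp only: F_P mm_assoc[symmetric, of "F j"] mm_assoc[of P "F j"])
  ultimately show ?thesis by (intro ext) (simp add: comm_def)
qed

text \<open>Rows \<open>0\<close> and \<open>1\<close> suffice. The row signs of \<open>F'\<close>
  are opposite there, so the rows give recurrences for \<open>a j + (-1) ^ j * b j\<close> and
  \<open>a j - (-1) ^ j * b j\<close>; \<open>K\<close> enters only the first.\<close>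

lemma F_F'_K_independent:
  assumes N: "N = Suc (2 * n)" and n: "1 \<le> n"
    and z: "\<And>x y. c * K x y + (\<Sum>j=1..n. a j * F j x y) + (\<Sum>j=1..n. b j * F' j x y) = 0"
  shows "c = 0" "j \<in> {1..n} \<Longrightarrow> a j = 0" "j \<in> {1..n} \<Longrightarrow> b j = 0"
proof -
  \<comment> \<open>Extension by zero outside \<open>{1..n}\<close> supplies the boundary values of
    the recurrences.\<close>
  define s where "s j = (if j \<in> {1..n} then a j + (-1) ^ j * b j else 0)" for j
  define t where "t j = (if j \<in> {1..n} then a j - (-1) ^ j * b j else 0)" for j
  have pick: "(\<Sum>j=1..n. g j * of_bool (j = k)) = (if k \<in> {1..n} then g k else 0)"
    for g :: "nat \<Rightarrow> real" and k
    by (simp add: of_bool_def if_distrib[of "\<lambda>x. _ * x"] cong: if_cong)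
  have s: "s (Suc i) + s i + c * (-1) ^ i = 0" if "i \<le> n" for i
  proof -
    have i: "2 * i < N" using that N by simp
    have "(\<Sum>j=1..n. a j * F j 0 (2 * i)) + (\<Sum>j=1..n. b j * F' j 0 (2 * i)) =
        (\<Sum>j=1..n. (a j + (-1) ^ j * b j) * F j 0 (2 * i))"
      by (simp add: F'_def algebra_simps sum.distrib)
    also have "\<dots> = (\<Sum>j=1..n. (a j + (-1) ^ j * b j) * of_bool (j = Suc i)
        + (a j + (-1) ^ j * b j) * of_bool (j = i))"
      by (intro sum.cong refl) (use F_row_0[OF N _ i] in \<open>auto simp: algebra_simps\<close>)
    also have "\<dots> = s (Suc i) + s i"
      unfolding sum.distrib pick s_def ..
    finally show ?thesis using z[of 0 "2 * i"] i by (simp add: K_def)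
  qed
  have t: "t i + 2 * t (Suc i) + t (Suc (Suc i)) = 0" if "i < n" for i
  proof -
    have i: "Suc (2 * i) < N" using that N by simp
    have "(\<Sum>j=1..n. a j * F j 1 (Suc (2 * i))) + (\<Sum>j=1..n. b j * F' j 1 (Suc (2 * i))) =
        (\<Sum>j=1..n. (a j - (-1) ^ j * b j) * F j 1 (Suc (2 * i)))"
      by (simp add: F'_def algebra_simps sum_subtractf sum_negf)
    also have "\<dots> = (\<Sum>j=1..n. (a j - (-1) ^ j * b j) * of_bool (j = i)
        + 2 * ((a j - (-1) ^ j * b j) * of_bool (j = Suc i))
        + (a j - (-1) ^ j * b j) * of_bool (j = Suc (Suc i)))"
      by (intro sum.cong refl) (use F_row_1[OF N _ i] in \<open>auto simp: algebra_simps\<close>)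
    also have "\<dots> = t i + 2 * t (Suc i) + t (Suc (Suc i))"
      unfolding sum.distrib sum_distrib_left[symmetric] pick t_def ..
    finally show ?thesis using z[of 1 "Suc (2 * i)"] by (simp add: K_def)
  qed
  have s0: "s 0 = 0" "s (Suc n) = 0" and t0: "t 0 = 0" "t (Suc n) = 0"
    by (simp_all add: s_def t_def)
  show "c = 0" using alternating_recurrence(1)[OF s0 s] .
  assume j: "j \<in> {1..n}"
  have "s j = 0" using alternating_recurrence(2)[OF s0 s] j by simp
  moreover have "t j = 0" using second_order_recurrence[OF t0 t] j by simp
  ultimately have "a j + (-1) ^ j * b j = 0" "a j - (-1) ^ j * b j = 0"
    using j by (simp_all add: s_def t_def)
  then have "a j = 0" "(-1) ^ j * b j = 0" by simp_all
  then show "a j = 0" "b j = 0" by simp_all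
qed

end

section \<open>Intertwining maps\<close>

context path_matrices begin

text \<open>The linear extension of \<open>T\<close> carries the adjacency operator of
  \<open>G\<close> to two-sided multiplication by \<open>P\<close>.\<close>

definition intertwines :: "'w wgraph \<Rightarrow> ('w \<Rightarrow> nat \<Rightarrow> nat \<Rightarrow> real) \<Rightarrow> bool" where
  "intertwines G T \<longleftrightarrow> (\<forall>w\<in>verts G. \<forall>x y.
     (P \<star> T w \<star> P) x y = (\<Sum>w'\<in>verts G. adj_entry G w' w * T w' x y))"

lemma intertwines_disjoint_union:
  assumes "finite (verts G)" "finite (verts H)" "intertwines G S" "intertwines H T"
  shows "intertwines (G \<union>\<^sub>G H) (case_sum S T)"
  using assms by (auto simp: intertwines_def sum.Plus)

text \<open>The commutator commutes with two-sided multiplication by \<open>P\<close>; this yields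
  the second copy of the halved diamond.\<close>

lemma intertwines_comm:
  assumes "intertwines G T" shows "intertwines G (\<lambda>w. comm (T w))"
  unfolding intertwines_def
proof (intro ballI allI)
  fix w x y assume "w \<in> verts G"
  then have "P \<star> T w \<star> P = (\<lambda>x y. \<Sum>w'\<in>verts G. adj_entry G w' w * T w' x y)"
    using assms by (intro ext) (auto simp: intertwines_def)
  then show "(P \<star> comm (T w) \<star> P) x y = (\<Sum>w'\<in>verts G. adj_entry G w' w * comm (T w') x y)"
    by (simp only: P_comm_P comm_sum)
qed

lemma sum_adj_entry_OD:
  assumes N: "N = 2 * n + 1" and xy: "(x, y) \<in> black_squares n"
  shows "(\<Sum>v\<in>black_squares n. adj_entry (OD n) (x, y) v * G (fst v) (snd v)) = (P \<star> G \<star> P) x y"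
proof -
  have sub: "black_squares n \<subseteq> {..<N} \<times> {..<N}"
    by (auto simp: black_squares_def N)
  have bd: "x < N" "y < N" "even (x + y)" using xy by (auto simp: black_squares_def N)
  \<comment> \<open>A step in both coordinates keeps the colour, so the sum over the whole board
    reduces to the black squares.\<close>
  have nz: "(k, l) \<in> black_squares n" if "P x k * P l y \<noteq> 0" for k l
  proof -
    have "k < N" "l < N" "consecutive x k" "consecutive l y"
      using that by (simp_all add: P_def split: if_splits)
    then have "even (k + l)" using bd(3) by auto
    then show ?thesis using \<open>k < N\<close> \<open>l < N\<close> unfolding black_squares_def N by simp
  qed
  have "(P \<star> G \<star> P) x y = (\<Sum>k<N. \<Sum>l<N. P x k * G k l * P l y)"
    by (simp add: mm_def sum_distrib_left mult.assoc)
  also have "\<dots> = (\<Sum>v\<in>{..<N} \<times> {..<N}. P x (fst v) * G (fst v) (snd v) * P (snd v) y)"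
    unfolding sum.cartesian_product by (intro sum.cong) auto
  also have "\<dots> = (\<Sum>v\<in>black_squares n. P x (fst v) * G (fst v) (snd v) * P (snd v) y)"
    by (intro sum.mono_neutral_right sub) (use nz in auto)
  also have "\<dots> = (\<Sum>v\<in>black_squares n. adj_entry (OD n) (x, y) v * G (fst v) (snd v))"
  proof (intro sum.cong refl)
    fix v assume v: "v \<in> black_squares n"
    obtain k l where kl: "v = (k, l)" by fastforce
    show "P x (fst v) * G (fst v) (snd v) * P (snd v) y = adj_entry (OD n) (x, y) v * G (fst v) (snd v)"
    proof -
      have "k < N" "l < N" using v sub kl by auto
      then have "P x k * P l y = of_bool (consecutive x k \<and> consecutive y l)"
        using bd by (simp add: P_def disj_commute conj_commute)
      also have "\<dots> = adj_entry (OD n) (x, y) v"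
        using adj_entry_OD[OF xy] v kl by simp
      finally show ?thesis unfolding kl by (simp add: mult.assoc mult.left_commute)
    qed
  qed
  finally show ?thesis ..
qed

text \<open>The shift by \<open>2\<close> moves the squares with \<open>fst w\<close> at most
  \<open>snd w\<close> to the black squares strictly above the diagonal of the larger board.\<close>

definition wedge :: "nat \<times> nat \<Rightarrow> nat \<Rightarrow> nat \<Rightarrow> real" where
  "wedge w x y = of_bool (x = fst w \<and> y = snd w + 2) - of_bool (x = snd w + 2 \<and> y = fst w)"

lemma wedge_antisym: "wedge w y x = - wedge w x y"
  by (simp add: wedge_def conj_commute)

text \<open>The guards \<open>2 \<le> y\<close> and \<open>2 \<le> x\<close> exclude truncated
  subtraction.\<close>

lemma sum_wedge:
  assumes "finite V"
  shows "(\<Sum>w\<in>V. g w * wedge w x y) =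
    (if 2 \<le> y \<and> (x, y - 2) \<in> V then g (x, y - 2) else 0) -
    (if 2 \<le> x \<and> (y, x - 2) \<in> V then g (y, x - 2) else 0)"
proof -
  have "(\<Sum>w\<in>V. g w * wedge w x y) =
      (\<Sum>w\<in>V. (if w = (x, y - 2) then if 2 \<le> y then g w else 0 else 0)
        - (if w = (y, x - 2) then if 2 \<le> x then g w else 0 else 0))"
  proof (intro sum.cong refl)
    fix w
    have 1: "x = fst w \<and> y = snd w + 2 \<longleftrightarrow> w = (x, y - 2) \<and> 2 \<le> y"
      and 2: "x = snd w + 2 \<and> y = fst w \<longleftrightarrow> w = (y, x - 2) \<and> 2 \<le> x"
      by (cases w; auto)+
    have b: "r * (of_bool (A \<and> B) - of_bool (C \<and> D)) =
      (if A then if B then r else 0 else 0) - (if C then if D then r else 0 else 0)"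
      for A B C D and r :: real by simp
    show "g w * wedge w x y = (if w = (x, y - 2) then if 2 \<le> y then g w else 0 else 0)
        - (if w = (y, x - 2) then if 2 \<le> x then g w else 0 else 0)"
      unfolding wedge_def 1 2 by (rule b)
  qed
  then show ?thesis using assms by (simp add: sum_subtractf)
qed

lemma mm_unit_mm:
  assumes "a < N" "b < N"
  shows "(G \<star> (\<lambda>x y. of_bool (x = a \<and> y = b)) \<star> H) x y = G x a * H b y"
proof -
  have "((\<lambda>x y. of_bool (x = a \<and> y = b)) \<star> H) k y = of_bool (k = a) * H b y" for k
  proof -
    have "((\<lambda>x y. of_bool (x = a \<and> y = b)) \<star> H) k y = (\<Sum>l<N. if l = b then of_bool (k = a) * H b y else 0)"
      unfolding mm_def by (intro sum.cong) auto
    then show ?thesis using assms by simp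
  qed
  then have "(G \<star> (\<lambda>x y. of_bool (x = a \<and> y = b)) \<star> H) x y =
      (\<Sum>k<N. if k = a then G x a * H b y else 0)"
    unfolding mm_def[of G] by (intro sum.cong) auto
  then show ?thesis using assms by simp
qed

text \<open>Neighbours of a square strictly above the diagonal lie above it or on it. Those on it
  cancel by antisymmetry, and the others are the neighbours in the halved diamond.\<close>

lemma intertwines_HOD:
  assumes N: "N = 2 * m + 3" shows "intertwines (HOD m) wedge"
  unfolding intertwines_def
proof (intro ballI allI)
  fix w x y assume w: "w \<in> verts (HOD m)"
  obtain a b where ab: "w = (a, b)" by fastforce
  have V: "a \<le> b" "b + 2 < N" "even (a + b)" using w ab N by (auto simp: verts_HOD)
  \<comment> \<open>\<open>h\<close> is the image of the unit matrix at \<open>(a, b + 2)\<close>;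
    \<open>r\<close> is what the halved diamond prescribes. They need agree only off the
    diagonal.\<close>
  define h where "h x y = P x a * P (b + 2) y" for x y
  define r where "r x y = (if 2 \<le> y \<and> (x, y - 2) \<in> verts (HOD m)
    then adj_entry (HOD m) (x, y - 2) (a, b) else 0)" for x y
  have hr: "h x y = r x y \<and> h y x = r y x" if "x < y" for x y
  proof
    have "\<not> (consecutive y a \<and> consecutive (b + 2) x)" using that V(1) by arith
    moreover have "\<not> (2 \<le> x \<and> (y, x - 2) \<in> verts (HOD m))" using that by (auto simp: verts_HOD)
    ultimately show "h y x = r y x" unfolding h_def r_def P_def by auto
    show "h x y = r x y"
    proof (cases "2 \<le> y \<and> (x, y - 2) \<in> verts (HOD m)")
      case True
      then have "adj_entry (HOD m) (x, y - 2) (a, b) = of_bool (consecutive x a \<and> consecutive (y - 2) b)"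
        using w ab by (intro adj_entry_HOD) auto
      moreover have "consecutive (y - 2) b \<longleftrightarrow> consecutive (b + 2) y" using True by auto
      moreover have "x < N" "a < N" "y < N" using True V N by (auto simp: verts_HOD)
      ultimately show ?thesis using True V(2) by (auto simp: r_def h_def P_def)
    next
      case False
      \<comment> \<open>A neighbour strictly above the diagonal is black, so
        \<open>x + 2 \<le> y\<close> and \<open>(x, y - 2)\<close> would be a vertex.\<close>
      have "\<not> (x < N \<and> y < N \<and> consecutive x a \<and> consecutive (b + 2) y)"
      proof
        assume *: "x < N \<and> y < N \<and> consecutive x a \<and> consecutive (b + 2) y"
        then have "even (x + y)" using V(3) by auto
        moreover from this have "x + 2 \<le> y" using that by presburger
        ultimately show False using False * N by (auto simp: verts_HOD)
      qed
      then show ?thesis using False unfolding r_def h_def P_def by auto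
    qed
  qed
  have "wedge w = (\<lambda>x y. of_bool (x = a \<and> y = b + 2) - of_bool (x = b + 2 \<and> y = a))"
    by (intro ext) (simp add: wedge_def ab)
  then have "(P \<star> wedge w \<star> P) x y = h x y - h y x"
    using V by (simp add: mm_diff_left mm_diff_right mm_unit_mm h_def P_commute mult.commute)
  also have "\<dots> = r x y - r y x"
    using hr[of x y] hr[of y x] by (cases x y rule: linorder_cases) auto
  also have "\<dots> = (\<Sum>w'\<in>verts (HOD m). adj_entry (HOD m) w' w * wedge w' x y)"
    by (simp add: sum_wedge finite_verts_HOD r_def ab)
  finally show "(P \<star> wedge w \<star> P) x y = (\<Sum>w'\<in>verts (HOD m). adj_entry (HOD m) w' w * wedge w' x y)" .
qed

lemma wedge_supported:
  assumes N: "N = 2 * m + 3" and w: "w \<in> verts (HOD m)"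
  shows "supported (wedge w)"
proof -
  have "fst w < N" "snd w + 2 < N" "even (fst w + snd w)"
    using w N by (auto simp: verts_HOD)
  then show ?thesis
    unfolding supported_def wedge_def by (auto simp: add.commute)
qed

lemma intertwines_P1:
  assumes "odd N" shows "intertwines (path_graph 1) (\<lambda>_. K)"
proof -
  have "adj_entry (path_graph 1) i j = 0" for i j
    by (simp add: adj_entry_def path_graph_def)
  then show ?thesis by (simp add: intertwines_def K_P assms)
qed

lemma intertwines_Q:
  assumes N: "N = Suc (2 * n)"
  shows "intertwines (Q_graph n) F"
  unfolding intertwines_def Q_graph_def verts_looped_path
proof (intro ballI allI)
  fix j x y assume j: "j \<in> {1..n}"
  then obtain i where i: "j = Suc i" by (cases j) auto
  show "(P \<star> F j \<star> P) x y = (\<Sum>i=1..n. adj_entry (add_loops 2 (path_graph n)) i j * F i x y)"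
    using j by (subst sum_adj_entry_looped_path) (simp_all add: F_last[OF N] i P_F_P)
qed

lemma intertwines_Q':
  assumes N: "N = Suc (2 * n)"
  shows "intertwines (Q'_graph n) F'"
  unfolding intertwines_def Q'_graph_def verts_looped_path
proof (intro ballI allI)
  fix j x y assume j: "j \<in> {1..n}"
  then obtain i where i: "j = Suc i" by (cases j) auto
  show "(P \<star> F' j \<star> P) x y = (\<Sum>i=1..n. adj_entry (add_loops (-2) (path_graph n)) i j * F' i x y)"
    using j by (subst sum_adj_entry_looped_path) (simp_all add: F'_last[OF N] i P_F'_P)
qed

end

text \<open>The black squares above the diagonal correspond to the vertices of \<open>HOD m\<close>
  by a shift of \<open>2\<close>, those below are their mirror images, and the diagonal is entirely
  black.\<close>

lemma card_black_squares:
  "card (black_squares (Suc m)) = 2 * card (verts (HOD m)) + 2 * Suc m + 1"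
proof -
  define V where "V = verts (HOD m)"
  define A B D where "A = (\<lambda>(a, b). (a, b + 2)) ` V" and "B = (\<lambda>(a, b). (b + 2, a)) ` V"
    and "D = (\<lambda>i. (i, i)) ` {..<2 * Suc m + 1}"
  have fin: "finite A" "finite B" "finite D"
    using finite_verts_HOD[of m] by (auto simp: A_def B_def D_def V_def)
  have A: "A = {(x, y). x < y \<and> y < 2 * Suc m + 1 \<and> even (x + y)}"
  proof (intro equalityI subsetI)
    fix v assume v: "v \<in> {(x, y). x < y \<and> y < 2 * Suc m + 1 \<and> even (x + y)}"
    obtain x y where xy: "v = (x, y)" by fastforce
    have "x < y" "even (x + y)" using v xy by auto
    then have "x + 2 \<le> y" by presburger
    then have "(x, y - 2) \<in> V" "v = (x, (y - 2) + 2)" using v xy by (auto simp: V_def verts_HOD)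
    then show "v \<in> A" unfolding A_def by force
  qed (auto simp: A_def V_def verts_HOD)
  have B: "B = prod.swap ` A" by (force simp: A_def B_def)
  have "black_squares (Suc m) = (A \<union> B) \<union> D"
  proof (intro equalityI subsetI)
    fix v assume v: "v \<in> black_squares (Suc m)"
    obtain x y where xy: "v = (x, y)" by fastforce
    show "v \<in> (A \<union> B) \<union> D"
    proof (cases x y rule: linorder_cases)
      case less then show ?thesis using v by (auto simp: A xy black_squares_def)
    next
      case equal then show ?thesis using v by (auto simp: D_def xy black_squares_def)
    next
      case greater
      then have "(y, x) \<in> A" using v by (auto simp: A xy black_squares_def add.commute)
      then show ?thesis unfolding B xy by force
    qed
  qed (auto simp: A B D_def black_squares_def add.commute)
  moreover have "A \<inter> B = {}" "(A \<union> B) \<inter> D = {}" by (auto simp: A B D_def)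
  moreover have "card A = card V" "card B = card V" "card D = 2 * Suc m + 1"
    by (auto simp: A_def B_def D_def inj_on_def intro!: card_image[THEN trans])
  ultimately show ?thesis
    using fin by (simp add: card_Un_disjoint V_def)
qed

section \<open>Combining the five components\<close>

theorem theorem3p3:
  fixes n :: nat
  assumes "n \<ge> 1"
  shows "OD n \<sim>\<^sub>G
           HOD (n - 1) \<union>\<^sub>G HOD (n - 1) \<union>\<^sub>G path_graph 1 \<union>\<^sub>G Q_graph n \<union>\<^sub>G Q'_graph n"
proof -
  obtain m where m: "n = Suc m" using assms by (cases n) auto
  define N where "N = 2 * n + 1"
  interpret path_matrices N .
  let ?H = "HOD m \<union>\<^sub>G HOD m \<union>\<^sub>G path_graph 1 \<union>\<^sub>G Q_graph n \<union>\<^sub>G Q'_graph n"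
  define T where "T = case_sum wedge (case_sum (\<lambda>w. comm (wedge w)) (case_sum (\<lambda>_::nat. K) (case_sum F F')))"
  define V where "V = verts (HOD m)"
  have N: "N = 2 * m + 3" "odd N" "N = Suc (2 * n)"
    using m by (simp_all add: N_def)
  have finV: "finite V" by (simp add: V_def finite_verts_HOD)
  have V1: "verts (path_graph (Suc 0)) = {Suc 0}" by (simp add: path_graph_def)
  have VQ: "verts (Q_graph n) = {1..n}" "verts (Q'_graph n) = {1..n}"
    by (simp_all add: Q_graph_def Q'_graph_def)
  have "intertwines ?H T"
    unfolding T_def
    by (intro intertwines_disjoint_union intertwines_comm intertwines_HOD intertwines_P1
        intertwines_Q intertwines_Q' N) (simp_all add: finite_verts_HOD V1 VQ)
  then have tw: "mm P (mm (T w) P) x y = (\<Sum>w'\<in>verts ?H. adj_entry ?H w' w * T w' x y)"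
    if "w \<in> verts ?H" for w x y
    using that unfolding intertwines_def by blast
  have supp: "supported (wedge w)" if "w \<in> V" for w
    using that wedge_supported[OF N(1)] by (simp add: V_def)
  have "OD n \<sim>\<^sub>G ?H"
  proof (rule graph_similarI[where T = "\<lambda>w v. T w (fst v) (snd v)"])
    show "finite (verts (OD n))" by (simp add: finite_black_squares)
    show "finite (verts ?H)" by (simp add: finite_verts_HOD V1 VQ)
    show "card (verts (OD n)) = card (verts ?H)"
      using card_black_squares[of m] by (simp add: m[symmetric] card_Plus finite_verts_HOD V1 VQ)
  next
    fix v w assume v: "v \<in> verts (OD n)" and w: "w \<in> verts ?H"
    then show "(\<Sum>v'\<in>verts (OD n). adj_entry (OD n) v v' * T w (fst v') (snd v')) =
        (\<Sum>w'\<in>verts ?H. adj_entry ?H w' w * T w' (fst v) (snd v))"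
      using sum_adj_entry_OD[OF N_def, of "fst v" "snd v" "T w"] tw[OF w] by simp
  next
    fix c w
    assume z: "\<And>v. v \<in> verts (OD n) \<Longrightarrow> (\<Sum>w\<in>verts ?H. c w * T w (fst v) (snd v)) = 0"
      and w: "w \<in> verts ?H"
    \<comment> \<open>The vanishing combination splits into an antisymmetric matrix
      \<open>X\<close>, a commutator of an antisymmetric \<open>Y\<close>, and a symmetric
      \<open>C\<close> in the kernel of \<open>comm\<close>.\<close>
    define X where "X x y = (\<Sum>w\<in>V. c (Inl w) * wedge w x y)" for x y
    define Y where "Y x y = (\<Sum>w\<in>V. c (Inr (Inl w)) * wedge w x y)" for x y
    define k where "k = c (Inr (Inr (Inl 1)))"
    define a where "a j = c (Inr (Inr (Inr (Inl j))))" for j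
    define b where "b j = c (Inr (Inr (Inr (Inr j))))" for j
    define C where "C x y = k * K x y + (\<Sum>j=1..n. a j * F j x y) + (\<Sum>j=1..n. b j * F' j x y)" for x y
    have sum_supp: "supported (\<lambda>x y. \<Sum>w\<in>W. g w * S w x y)" if "\<And>w. w \<in> W \<Longrightarrow> supported (S w)"
      for W :: "'b set" and g S
      using that unfolding supported_def by (metis (no_types, lifting) mult_zero_right sum.neutral)
    have X: "supported X" "X y x = - X x y" and Y: "supported Y" "Y y x = - Y x y" for x y
      unfolding X_def[abs_def] Y_def[abs_def]
      by (auto intro!: sum_supp supp simp: wedge_antisym[of _ y x] sum_negf)
    have "supported C"
      unfolding supported_def C_def
      using K_supported sum_supp[of "{1..n}" F a] sum_supp[of "{1..n}" F' b] F_supported F'_supported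
      unfolding supported_def by (metis (no_types, lifting) add_0 mult_zero_right)
    have C: "C y x = C x y" "comm C = (\<lambda>x y. 0)" for x y
      unfolding C_def[abs_def] comm_add comm_sum
      \<comment> \<open>The multiple \<open>k * K\<close> is treated as a sum over a one-element
        set.\<close>
      using comm_sum[of "\<lambda>_. k" "\<lambda>_. K" "{()}"]
      by (auto simp: K_sym[of x y] F_sym[of _ x y] F'_sym[of _ x y] comm_F comm_F' comm_K[OF N(2)])
    have "X x y + comm Y x y + C x y = 0" for x y
    proof (cases "(x, y) \<in> black_squares n")
      case True
      have "comm Y x y = (\<Sum>w\<in>V. c (Inr (Inl w)) * comm (wedge w) x y)"
        unfolding Y_def[abs_def] comm_sum ..
      then show ?thesis
        using z[of "(x, y)"] True
        by (simp add: sum.Plus finite_verts_HOD V1 VQ T_def X_def C_def k_def a_def b_def V_def)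
    next
      case False
      \<comment> \<open>Off the black squares the hypothesis says nothing, but each summand vanishes
        by its support.\<close>
      then have "\<not> (x < N \<and> y < N \<and> even (x + y))"
        by (simp add: black_squares_def N_def)
      then show ?thesis
        using supported_zero[OF X(1)] supported_zero[OF supported_comm[OF Y(1)]]
          supported_zero[OF \<open>supported C\<close>] by simp
    qed
    note zero = independent[OF X Y C this]
    have "g w = 0" if "(\<lambda>x y. \<Sum>w\<in>V. g w * wedge w x y) = (\<lambda>x y. 0)" "w \<in> V" for g w
    proof -
      \<comment> \<open>The entry at \<open>(fst w, snd w + 2)\<close> isolates the coefficient of
        \<open>w\<close>.\<close>
      have "(\<Sum>w\<in>V. g w * wedge w (fst w') (snd w' + 2)) = 0" for w'
        using that(1) by (metis (no_types))
      from this[of w] show ?thesis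
        using that(2) sum_wedge[OF finV, of g "fst w" "snd w + 2"]
        by (auto simp: V_def verts_HOD split: if_splits)
    qed
    from this[of "\<lambda>w. c (Inl w)"] this[of "\<lambda>w. c (Inr (Inl w))"]
    have "w \<in> V \<Longrightarrow> c (Inl w) = 0" "w \<in> V \<Longrightarrow> c (Inr (Inl w)) = 0" for w
      using zero(1,2) unfolding X_def[abs_def] Y_def[abs_def] by blast+
    moreover have "k * K x y + (\<Sum>j=1..n. a j * F j x y) + (\<Sum>j=1..n. b j * F' j x y) = 0" for x y
      using zero(3) unfolding C_def by (metis (no_types))
    from F_F'_K_independent[OF N(3) assms this]
    have "k = 0" "j \<in> {1..n} \<Longrightarrow> a j = 0" "j \<in> {1..n} \<Longrightarrow> b j = 0" for j by simp_all
    ultimately show "c w = 0"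
      using w by (auto simp: V1 VQ k_def a_def b_def V_def)
  qed
  then show ?thesis by (simp add: m)
qed

end
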